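(* There exists a $4$-irregular graph $G$, obtained from the Petersen graph by adding one vertex and three edges, such that $G^2 = K_{11}$, and hence $\chi_l(G^2)=11$.
   Context: All graphs are finite and simple. A graph $G$ is $k$-irregular if its maximum degree is $\Delta(G)=k$ and no two vertices of degree $k$ are adjacent in $G$. The square $G^2$ of $G$ is the graph obtained from $G$ by adding an edge between any two vertices at distance $2$ in $G$. $K_{11}$ is the complete graph on $11$ vertices. A list assignment $L$ of a graph $H$ assigns to each vertex $v$ a set $L(v)$ of permissible colors; $H$ is $L$-colorable if there is a proper coloring $f$ of $H$ with $f(v)\in L(v)$ for every vertex $v$. $H$ is $k$-choosable if it is $L$-colorable for every list assignment $L$ in which each $L(v)$ has exactly $k$ colors. The list chromatic number $\chi_l(H)$ is the smallest integer $k$ for which $H$ is $k$-choosable. *)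

theory Defs
  imports "Graph_Theory.Graph_Theory"
begin

text \<open>
  Finite simple graphs are the symmetric loopfree pair digraphs \<^locale>\<open>pair_graph\<close>: an
  undirected edge \<open>uv\<close> is represented by the two arcs \<open>(u, v)\<close> and \<open>(v, u)\<close>, so the degree of a
  vertex is its out-degree, and undirected edges are counted through \<open>edges\<close> below.
\<close>

definition edges :: "'a pair_pre_digraph \<Rightarrow> 'a set set" where
  "edges G = (\<lambda>(u, v). {u, v}) ` parcs G"

definition degree :: "'a pair_pre_digraph \<Rightarrow> 'a \<Rightarrow> nat" where
  "degree G v = out_degree (with_proj G) v"

definition max_degree :: "'a pair_pre_digraph \<Rightarrow> nat" where
  "max_degree G = Max (degree G ` pverts G)"

definition irregular_graph :: "nat \<Rightarrow> 'a pair_pre_digraph \<Rightarrow> bool" where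
  "irregular_graph k G \<longleftrightarrow>
     pair_graph G \<and> max_degree G = k \<and>
     (\<forall>u \<in> pverts G. \<forall>v \<in> pverts G. degree G u = k \<and> degree G v = k \<longrightarrow> (u, v) \<notin> parcs G)"

text \<open>Walks are measured with unit arc weights, so that \<open>\<mu>\<close> is the usual graph distance.\<close>

definition graph_dist :: "'a pair_pre_digraph \<Rightarrow> 'a \<Rightarrow> 'a \<Rightarrow> ereal" where
  "graph_dist G u v = wf_digraph.\<mu> (with_proj G) (\<lambda>_. 1) u v"

definition square :: "'a pair_pre_digraph \<Rightarrow> 'a pair_pre_digraph" where
  "square G = \<lparr> pverts = pverts G,
     parcs = parcs G \<union> {(u, v). u \<in> pverts G \<and> v \<in> pverts G \<and> graph_dist G u v = 2} \<rparr>"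

text \<open>The Petersen graph as the Kneser graph on the 2-subsets of a 5-set.\<close>

definition petersen :: "nat set pair_pre_digraph" where
  "petersen = (let V = {A. A \<subseteq> {0..<5} \<and> card A = 2} in
     \<lparr> pverts = V, parcs = {(A, B). A \<in> V \<and> B \<in> V \<and> A \<inter> B = {}} \<rparr>)"

definition obtained_by_adding ::
    "nat \<Rightarrow> nat \<Rightarrow> 'a pair_pre_digraph \<Rightarrow> 'a pair_pre_digraph \<Rightarrow> bool" where
  "obtained_by_adding m n P G \<longleftrightarrow>
     subgraph (with_proj P) (with_proj G) \<and>
     card (pverts G - pverts P) = m \<and> card (edges G - edges P) = n"

definition list_colorable :: "'a pair_pre_digraph \<Rightarrow> ('a \<Rightarrow> 'c set) \<Rightarrow> bool" where
  "list_colorable H L \<longleftrightarrow>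
     (\<exists>f. (\<forall>v \<in> pverts H. f v \<in> L v) \<and> (\<forall>(u, v) \<in> parcs H. f u \<noteq> f v))"

text \<open>
  Colors are natural numbers; for a finite graph only finitely many colors occur in the lists,
  so this is no restriction. Finiteness is explicit because \<open>card\<close> of an infinite set is 0.
\<close>

definition choosable :: "nat \<Rightarrow> 'a pair_pre_digraph \<Rightarrow> bool" where
  "choosable k H \<longleftrightarrow>
     (\<forall>L :: 'a \<Rightarrow> nat set.
        (\<forall>v \<in> pverts H. finite (L v) \<and> card (L v) = k) \<longrightarrow> list_colorable H L)"

definition list_chromatic_number :: "'a pair_pre_digraph \<Rightarrow> nat" where
  "list_chromatic_number H = (LEAST k. choosable k H)"

end

theory Submission
  imports Defs
begin

text \<open>
  The new vertex is a \<^emph>\<open>twin\<close> of a vertex \<open>v\<close> of the Petersen graph: it is joined to the three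
  neighbours of \<open>v\<close>. Two distinct nonadjacent vertices of the Petersen graph have a common
  neighbour (\<open>petersen_common_neighbour\<close>), so its square is complete. The twin sees every other vertex just as \<open>v\<close> does, and
  it shares with \<open>v\<close> the neighbours of \<open>v\<close>; hence the square remains complete, now on \<open>11\<close>
  vertices. The only degrees that grow are those of the neighbours of \<open>v\<close>, from \<open>3\<close> to \<open>4\<close>, and
  these are pairwise nonadjacent because the Petersen graph has no triangle.

  In the Kneser model, where adjacency is disjointness, \<open>v = {0, 1}\<close> can be duplicated without
  describing any edges by hand: the set \<open>{0, 1, 5}\<close> is disjoint from the same subsets of
  \<open>{0..<5}\<close> as \<open>{0, 1}\<close> (\<open>twin_disjoint_iff\<close>). The whole graph is therefore again a disjointness graph.

  Finally, a complete graph on \<open>n\<close> vertices has list chromatic number \<open>n\<close>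
  (\<open>list_chromatic_number_complete\<close>): lists of size \<open>n\<close> allow
  greedy coloring, and \<open>n\<close> pairwise adjacent vertices need \<open>n\<close> colors when all lists are equal.
\<close>

section \<open>List coloring of complete graphs\<close>

text \<open>
  This is greedy: when the last element is reached, its list is larger than the set of values
  already taken.
\<close>

lemma ex_inj_on_choice:
  assumes "finite V" and "\<And>v. v \<in> V \<Longrightarrow> finite (L v) \<and> card V \<le> card (L v)"
  shows "\<exists>f. inj_on f V \<and> (\<forall>v\<in>V. f v \<in> L v)"
  using assms
proof (induction V rule: finite_induct)
  case empty
  show ?case by simp
next
  case (insert x V)
  have "finite (L v) \<and> card V \<le> card (L v)" if "v \<in> V" for v
    using insert.prems[of v] insert.hyps that by simp
  then obtain f where f: "inj_on f V" "\<forall>v\<in>V. f v \<in> L v"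
    using insert.IH by blast
  have x: "finite (L x)" "Suc (card V) \<le> card (L x)"
    using insert.prems[of x] insert.hyps by simp_all
  have "card (f ` V) < card (L x)"
    using card_image_le[OF \<open>finite V\<close>, of f] x(2) by linarith
  then obtain c where c: "c \<in> L x" "c \<notin> f ` V"
    using card_mono[of "f ` V" "L x"] \<open>finite V\<close> by (meson finite_imageI leD subsetI)
  have "inj_on (f(x := c)) (insert x V)"
    using f(1) c(2) \<open>x \<notin> V\<close> by (auto simp: inj_on_def)
  moreover have "\<forall>v\<in>insert x V. (f(x := c)) v \<in> L v"
    using f(2) c(1) by auto
  ultimately show ?case by blast
qed

lemma list_colorable_complete_iff:
  assumes "K\<^bsub>n\<^esub> (with_proj H)"
  shows "list_colorable H L \<longleftrightarrow> (\<exists>f. inj_on f (pverts H) \<and> (\<forall>v\<in>pverts H. f v \<in> L v))"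
proof -
  have "parcs H = {(u, v). (u, v) \<in> pverts H \<times> pverts H \<and> u \<noteq> v}"
    using assms by (simp add: complete_digraph_pair_def)
  then have "(\<forall>(u, v)\<in>parcs H. f u \<noteq> f v) \<longleftrightarrow> inj_on f (pverts H)" for f :: "'a \<Rightarrow> 'b"
    by (auto simp: inj_on_def)
  then show ?thesis
    unfolding list_colorable_def by auto
qed

lemma choosable_complete_iff:
  assumes "K\<^bsub>n\<^esub> (with_proj H)"
  shows "choosable k H \<longleftrightarrow> n \<le> k"
proof
  have H: "finite (pverts H)" "card (pverts H) = n"
    using assms by (simp_all add: complete_digraph_pair_def)
  {
    assume "choosable k H"
    then have "list_colorable H (\<lambda>_. {..<k})"
      unfolding choosable_def by simp
    then obtain f :: "'a \<Rightarrow> nat" where "inj_on f (pverts H)" "f ` pverts H \<subseteq> {..<k}"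
      unfolding list_colorable_complete_iff[OF assms] by blast
    then show "n \<le> k"
      using H card_inj_on_le[of f "pverts H" "{..<k}"] by simp
  next
    assume "n \<le> k"
    then show "choosable k H"
      unfolding choosable_def list_colorable_complete_iff[OF assms]
      using H ex_inj_on_choice by metis
  }
qed

lemma list_chromatic_number_complete:
  assumes "K\<^bsub>n\<^esub> (with_proj H)"
  shows "list_chromatic_number H = n"
  unfolding list_chromatic_number_def choosable_complete_iff[OF assms]
  by (rule Least_equality) auto

section \<open>Squares of diameter-two graphs\<close>

lemma graph_dist_eq_2I:
  assumes "pair_graph G" and "u \<noteq> v" and "(u, v) \<notin> parcs G"
    and "(u, w) \<in> parcs G" and "(w, v) \<in> parcs G"
  shows "graph_dist G u v = 2"
proof -
  interpret pair_graph G by fact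
  have cost: "awalk_cost (\<lambda>_. 1) p = length p" for p :: "('a \<times> 'a) list"
    by (induction p) auto
  have "awalk u [(u, w), (w, v)] v"
    using assms by (auto simp: awalk_def intro: wellformed')
  then have "\<mu> (\<lambda>_. 1) u v \<le> awalk_cost (\<lambda>_. 1) [(u, w), (w, v)]"
    by (rule min_cost_le_walk_cost)
  then have le: "\<mu> (\<lambda>_. 1) u v \<le> 2"
    by simp
  have "2 \<le> length p" if "awalk u p v" for p
  proof (rule ccontr)
    assume "\<not> 2 \<le> length p"
    then consider "p = []" | e where "p = [e]"
      by (cases p; cases "tl p") auto
    then show False
      using that assms(2,3) by cases (auto simp: awalk_def)
  qed
  then have "2 \<le> \<mu> (\<lambda>_. 1) u v"
    unfolding \<mu>_def cost by (intro INF_greatest) auto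
  with le show ?thesis
    unfolding graph_dist_def by (rule antisym)
qed

lemma complete_square:
  assumes G: "pair_graph G"
    and common: "\<And>u v. u \<in> pverts G \<Longrightarrow> v \<in> pverts G \<Longrightarrow> u \<noteq> v \<Longrightarrow> (u, v) \<notin> parcs G \<Longrightarrow>
      \<exists>w. (u, w) \<in> parcs G \<and> (w, v) \<in> parcs G"
  shows "K\<^bsub>card (pverts G)\<^esub> (with_proj (square G))"
proof -
  interpret pair_graph G by fact
  have "graph_dist G u u \<noteq> 2" if "u \<in> pverts G" for u
  proof -
    have "\<mu> (\<lambda>_. 1) u u \<le> awalk_cost (\<lambda>_. 1) []"
      using that by (intro min_cost_le_walk_cost) (simp add: awalk_def)
    then have "graph_dist G u u \<le> 0"
      by (simp add: graph_dist_def zero_ereal_def)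
    then show ?thesis by auto
  qed
  moreover have "graph_dist G u v = 2"
    if "u \<in> pverts G" "v \<in> pverts G" "u \<noteq> v" "(u, v) \<notin> parcs G" for u v
    using graph_dist_eq_2I[OF G] common[OF that] that by blast
  ultimately have
    "parcs (square G) = {(u, v). (u, v) \<in> pverts G \<times> pverts G \<and> u \<noteq> v}"
    unfolding square_def by (auto dest: wellformed' no_loops')
  then show ?thesis
    unfolding complete_digraph_pair_def by (simp add: square_def pair_finite_verts)
qed

section \<open>Disjointness graphs\<close>

definition disjointness_graph :: "'a set set \<Rightarrow> 'a set pair_pre_digraph" where
  "disjointness_graph V = \<lparr> pverts = V, parcs = {(A, B). A \<in> V \<and> B \<in> V \<and> A \<inter> B = {}} \<rparr>"

lemma disjointness_graph_simps [simp]: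
  "pverts (disjointness_graph V) = V"
  "(A, B) \<in> parcs (disjointness_graph V) \<longleftrightarrow> A \<in> V \<and> B \<in> V \<and> A \<inter> B = {}"
  by (simp_all add: disjointness_graph_def)

text \<open>The empty set is disjoint from itself and would carry a loop.\<close>

lemma pair_graph_disjointness_graph:
  assumes "finite V" and "{} \<notin> V"
  shows "pair_graph (disjointness_graph V)"
proof
  show "finite (parcs (disjointness_graph V))"
    by (rule finite_subset[of _ "V \<times> V"]) (use assms in auto)
  show "symmetric (with_proj (disjointness_graph V))"
    by (auto simp: symmetric_def intro!: symI)
qed (use assms in \<open>auto simp: disjointness_graph_def\<close>)

lemma subgraph_disjointness_graph:
  assumes "V \<subseteq> W"
  shows "subgraph (with_proj (disjointness_graph V)) (with_proj (disjointness_graph W))"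
proof -
  have "wf_digraph (with_proj (disjointness_graph U))" for U :: "'a set set"
    by unfold_locales (auto simp: disjointness_graph_def)
  then show ?thesis
    using assms by (auto simp: subgraph_def compatible_def)
qed

lemma degree_disjointness_graph:
  assumes "A \<in> V"
  shows "degree (disjointness_graph V) A = card {B \<in> V. A \<inter> B = {}}"
proof -
  have "out_arcs (with_proj (disjointness_graph V)) A = Pair A ` {B \<in> V. A \<inter> B = {}}"
    using assms by (auto simp: out_arcs_def)
  then show ?thesis
    by (simp add: degree_def out_degree_def card_image inj_on_def)
qed

lemma card_new_edges_disjointness_graph:
  assumes "A \<notin> V" and "A \<noteq> {}"
  shows "card (edges (disjointness_graph (insert A V)) - edges (disjointness_graph V)) =
    card {B \<in> V. A \<inter> B = {}}"
proof -
  have edge: "E \<in> edges (disjointness_graph U) \<longleftrightarrow> (\<exists>B\<in>U. \<exists>C\<in>U. E = {B, C} \<and> B \<inter> C = {})"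
    for E and U :: "'a set set"
    by (simp add: edges_def image_iff Bex_def) blast
  have "edges (disjointness_graph (insert A V)) - edges (disjointness_graph V) =
      (\<lambda>B. {A, B}) ` {B \<in> V. A \<inter> B = {}}" (is "?new = ?img")
  proof (intro subset_antisym subsetI)
    fix E assume E: "E \<in> ?new"
    then obtain B C where BC: "B \<in> insert A V" "C \<in> insert A V" "E = {B, C}" "B \<inter> C = {}"
      unfolding edge Diff_iff by blast
    then have *: "B = A \<or> C = A"
      using E unfolding edge Diff_iff by blast
    have "B \<noteq> C"
      using BC(4) assms(2) * by auto
    with * consider "B = A" "C \<in> V" | "C = A" "B \<in> V"
      using BC by blast
    then show "E \<in> ?img"
      using BC by cases (auto simp: image_iff insert_commute Int_commute)
  next
    fix E assume "E \<in> ?img"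
    then obtain B where B: "B \<in> V" "A \<inter> B = {}" "E = {A, B}"
      by blast
    then have "E \<in> edges (disjointness_graph (insert A V))"
      unfolding edge by blast
    moreover have "E \<notin> edges (disjointness_graph V)"
      using B assms(1) unfolding edge by (auto simp: doubleton_eq_iff)
    ultimately show "E \<in> ?new" by blast
  qed
  moreover have "inj_on (\<lambda>B. {A, B}) {B \<in> V. A \<inter> B = {}}"
    by (auto simp: inj_on_def doubleton_eq_iff)
  ultimately show ?thesis
    by (simp add: card_image)
qed

section \<open>The Petersen graph with a twin vertex\<close>

definition petersen_verts :: "nat set set" where
  "petersen_verts = {A. A \<subseteq> {0..<5} \<and> card A = 2}"

definition twin :: "nat set" where
  "twin = {0, 1, 5}"

lemma petersen_eq: "petersen = disjointness_graph petersen_verts"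
  by (simp add: petersen_def disjointness_graph_def petersen_verts_def)

lemma finite_petersen_verts [simp]: "finite petersen_verts"
  unfolding petersen_verts_def by (rule finite_subset[of _ "Pow {0..<5}"]) auto

lemma empty_notin_petersen_verts: "{} \<notin> petersen_verts"
  by (simp add: petersen_verts_def)

lemma card_petersen_verts: "card petersen_verts = 10"
  unfolding petersen_verts_def using n_subsets[of "{0..<5::nat}" 2]
  by (simp add: numeral_eq_Suc)

lemma twin_notin: "twin \<notin> petersen_verts"
  by (auto simp: petersen_verts_def twin_def)

lemma original_mem: "{0, 1} \<in> petersen_verts"
  by (auto simp: petersen_verts_def)

lemma twin_disjoint_iff:
  assumes "B \<in> petersen_verts"
  shows "twin \<inter> B = {} \<longleftrightarrow> {0, 1} \<inter> B = {}"
  using assms by (auto simp: petersen_verts_def twin_def)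

lemma card_petersen_neighbours:
  assumes "A \<in> petersen_verts"
  shows "card {B \<in> petersen_verts. A \<inter> B = {}} = 3"
proof -
  have A: "A \<subseteq> {0..<5}" "card A = 2" "finite A"
    using assms by (auto simp: petersen_verts_def intro: finite_subset)
  have "{B \<in> petersen_verts. A \<inter> B = {}} = {B. B \<subseteq> {0..<5} - A \<and> card B = 2}"
    by (auto simp: petersen_verts_def)
  moreover have "card ({0..<5} - A) = 3"
    using A by (simp add: card_Diff_subset)
  ultimately show ?thesis
    using n_subsets[of "{0..<5} - A" 2] by (simp add: numeral_eq_Suc)
qed

text \<open>
  Two distinct intersecting \<open>2\<close>-sets cover three points of the \<open>5\<close>-set, and the two remaining
  points form the common neighbour.
\<close>

lemma petersen_common_neighbour:
  assumes A: "A \<in> petersen_verts" and B: "B \<in> petersen_verts" and AB: "A \<inter> B \<noteq> {}"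
  shows "\<exists>C\<in>petersen_verts. A \<inter> C = {} \<and> C \<inter> B = {}"
proof -
  have fin: "finite A" "finite B" and sub: "A \<union> B \<subseteq> {0..<5}" and card: "card A = 2" "card B = 2"
    using A B by (auto simp: petersen_verts_def intro: finite_subset)
  have "card (A \<inter> B) > 0"
    using AB fin by (simp add: card_gt_0_iff)
  then have "card (A \<union> B) \<le> 3"
    using card_Un_Int[OF fin] card by linarith
  then have "2 \<le> card ({0..<5} - (A \<union> B))"
    using fin sub by (simp add: card_Diff_subset)
  then obtain C where "C \<subseteq> {0..<5} - (A \<union> B)" "card C = 2"
    by (metis obtain_subset_with_card_n)
  then show ?thesis
    by (intro bexI[of _ C]) (auto simp: petersen_verts_def)
qed

abbreviation petersen_with_twin :: "nat set pair_pre_digraph" where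
  "petersen_with_twin \<equiv> disjointness_graph (insert twin petersen_verts)"

lemma pair_graph_petersen_with_twin: "pair_graph petersen_with_twin"
  by (rule pair_graph_disjointness_graph)
    (use empty_notin_petersen_verts in \<open>auto simp: twin_def\<close>)

lemma card_twin_neighbours: "card {B \<in> petersen_verts. twin \<inter> B = {}} = 3"
proof -
  have "{B \<in> petersen_verts. twin \<inter> B = {}} = {B \<in> petersen_verts. {0, 1} \<inter> B = {}}"
    using twin_disjoint_iff by blast
  then show ?thesis
    using card_petersen_neighbours[OF original_mem] by simp
qed

lemma degree_twin: "degree petersen_with_twin twin = 3"
proof -
  have "{B \<in> insert twin petersen_verts. twin \<inter> B = {}} = {B \<in> petersen_verts. twin \<inter> B = {}}"
    by (auto simp: twin_def)
  then show ?thesis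
    by (simp add: degree_disjointness_graph card_twin_neighbours)
qed

lemma degree_petersen_vertex:
  assumes "A \<in> petersen_verts"
  shows "degree petersen_with_twin A = (if {0, 1} \<inter> A = {} then 4 else 3)"
proof -
  have "{B \<in> insert twin petersen_verts. A \<inter> B = {}} =
      (if {0, 1} \<inter> A = {} then insert twin {B \<in> petersen_verts. A \<inter> B = {}}
       else {B \<in> petersen_verts. A \<inter> B = {}})"
    using twin_disjoint_iff[OF assms] by (auto simp: Int_commute)
  then show ?thesis
    using assms twin_notin
    by (simp add: degree_disjointness_graph card_petersen_neighbours)
qed

lemma irregular_petersen_with_twin: "irregular_graph 4 petersen_with_twin"
  unfolding irregular_graph_def
proof (intro conjI ballI impI)
  show "pair_graph petersen_with_twin"
    by (rule pair_graph_petersen_with_twin)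
  have "{2, 3} \<in> petersen_verts"
    by (auto simp: petersen_verts_def)
  then show "max_degree petersen_with_twin = 4"
    unfolding max_degree_def
    by (intro Max_eqI)
      (auto simp: degree_twin degree_petersen_vertex intro!: rev_image_eqI[of "{2, 3}"])
next
  fix A B
  assume "A \<in> pverts petersen_with_twin" "B \<in> pverts petersen_with_twin"
    and "degree petersen_with_twin A = 4 \<and> degree petersen_with_twin B = 4"
  then have A: "A \<in> petersen_verts" "{0, 1} \<inter> A = {}" and B: "B \<in> petersen_verts" "{0, 1} \<inter> B = {}"
    by (auto simp: degree_twin degree_petersen_vertex split: if_splits)
  (* A, B and {0, 1} cannot be pairwise disjoint: that would take six points *)
  have "A \<union> B \<subseteq> {0..<5} - {0, 1}"
    using A B by (auto simp: petersen_verts_def)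
  then have "card (A \<union> B) \<le> 3"
    using card_mono[of "{0..<5} - {0, 1::nat}" "A \<union> B"] by simp
  moreover have "card A = 2" "card B = 2" "finite A" "finite B"
    using A B by (auto simp: petersen_verts_def intro: finite_subset)
  ultimately have "A \<inter> B \<noteq> {}"
    using card_Un_disjoint[of A B] by auto
  then show "(A, B) \<notin> parcs petersen_with_twin"
    by simp
qed

lemma petersen_with_twin_obtained: "obtained_by_adding 1 3 petersen petersen_with_twin"
proof -
  have "insert twin petersen_verts - petersen_verts = {twin}"
    using twin_notin by auto
  moreover have "twin \<noteq> {}"
    by (simp add: twin_def)
  ultimately show ?thesis
    unfolding obtained_by_adding_def petersen_eq
    using subgraph_disjointness_graph[of petersen_verts "insert twin petersen_verts"]
    by (simp add: card_new_edges_disjointness_graph[OF twin_notin] card_twin_neighbours subset_insertI)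
qed

text \<open>
  A common neighbour of \<open>{0, 1}\<close> and \<open>B\<close> is also one of the twin and \<open>B\<close>. This
  includes \<open>B = {0, 1}\<close>, where any neighbour of \<open>{0, 1}\<close> serves.
\<close>

lemma complete_square_petersen_with_twin: "K\<^bsub>11\<^esub> (with_proj (square petersen_with_twin))"
proof -
  have twin: "\<exists>C\<in>petersen_verts. twin \<inter> C = {} \<and> C \<inter> B = {}"
    if B: "B \<in> petersen_verts" "twin \<inter> B \<noteq> {}" for B
  proof -
    obtain C where C: "C \<in> petersen_verts" "{0, 1} \<inter> C = {}" "C \<inter> B = {}"
      using petersen_common_neighbour[OF original_mem B(1)] twin_disjoint_iff B by blast
    then show ?thesis
      using twin_disjoint_iff[OF C(1)] by blast
  qed
  have "\<exists>C. (A, C) \<in> parcs petersen_with_twin \<and> (C, B) \<in> parcs petersen_with_twin"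
    if AB: "A \<in> insert twin petersen_verts" "B \<in> insert twin petersen_verts"
      "A \<noteq> B" "A \<inter> B \<noteq> {}" for A B
  proof -
    consider "A \<in> petersen_verts" "B \<in> petersen_verts"
      | "A = twin" "B \<in> petersen_verts" | "A \<in> petersen_verts" "B = twin"
      using AB by blast
    then have "\<exists>C\<in>petersen_verts. A \<inter> C = {} \<and> C \<inter> B = {}"
    proof cases
      case 1
      then show ?thesis using petersen_common_neighbour AB by blast
    next
      case 2
      then show ?thesis using twin AB by blast
    next
      case 3
      then show ?thesis using twin[of A] AB by (auto simp: Int_commute)
    qed
    then show ?thesis
      using AB by auto
  qed
  moreover have "card (insert twin petersen_verts) = 11"
    using twin_notin by (simp add: card_petersen_verts)
  ultimately show ?thesis
    using complete_square[OF pair_graph_petersen_with_twin] by simp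
qed

theorem mainTheorem2:
  shows "\<exists>G :: nat set pair_pre_digraph.
           irregular_graph 4 G \<and>
           obtained_by_adding 1 3 petersen G \<and>
           K\<^bsub>11\<^esub> (with_proj (square G)) \<and>
           list_chromatic_number (square G) = 11"
  using irregular_petersen_with_twin petersen_with_twin_obtained
    complete_square_petersen_with_twin
    list_chromatic_number_complete[OF complete_square_petersen_with_twin]
  by blast

end
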